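(* Consider the problem $\min_{x\in\Omega_1}F(x)$ with $F(x)=f(x)+g(x)$ and $f(x)=\max_{u\in\Omega_2}\langle Ax,u\rangle-\phi(u)$, where $\Omega_1\subseteq\mathbb{R}^d$ is a closed convex set, $\Omega_2\subset\mathbb{R}^m$ is a closed convex bounded set, $A\in\mathbb{R}^{m\times d}$, and $g:\mathbb{R}^d\to\mathbb{R}$, $\phi:\mathbb{R}^m\to\mathbb{R}$ are convex functions ($f$ and $g$ need not be smooth). Let $F_*=\min_{x\in\Omega_1}F(x)$ and let $\Omega_*$ be the set of minimizers of $F$ over $\Omega_1$. Assume: (i) $x_0\in\Omega_1$ and $\epsilon_0$ satisfy $F(x_0)-F_*\le\epsilon_0$; (ii) $\omega_+$ is a nonnegative continuous function on $\Omega_2$ that is $1$-strongly convex with respect to a norm $\|\cdot\|_+$ on $\mathbb{R}^m$, and $D$ is a constant with $\max_{u\in\Omega_2}\omega_+(u)\le D^2/2$; (iii) $\Omega_*$ is a non-empty convex compact set. Let $0<\epsilon\le\epsilon_0$ and suppose $F$ obeys the local error bound condition: there are $\theta\in(0,1]$ and $c>0$ such that $\mathrm{dist}(x,\Omega_* )\le c\,(F(x)-F_* )^{\theta}$ for every $x\in\Omega_1$ with $F(x)\le F_*+\epsilon$. Let $b>1$. Run the algorithm HOPS (defined in the context) from $x_0$ with $m=\lceil\log_b(\epsilon_0/\epsilon)\rceil$ stages and with $$t=O\!\left(\frac{2bcD\|A\|}{\epsilon^{1-\theta}}\right),\qquad t\ \ge\ \frac{2bcD\|A\|}{\epsilon^{1-\theta}}$$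 iterations in each stage. Then its output $x_m$ satisfies $$F(x_m)-F_*\le 2\epsilon .$$ Hence the iteration complexity (total number of inner iterations over all stages) for achieving a $2\epsilon$-optimal solution is, up to rounding the per-stage iteration number up to an integer, $\frac{2bcD\|A\|}{\epsilon^{1-\theta}}\left\lceil\log_b\left(\frac{\epsilon_0}{\epsilon}\right)\right\rceil$ in the worst case.
   Context: $\|\cdot\|$ on $\mathbb{R}^d$ is the Euclidean norm, $\mathrm{dist}(x,\Omega_* )=\min_{z\in\Omega_*}\|x-z\|$, and $\|A\|=\max_{\|x\|\le1}\max_{\|u\|_+\le1}\langle Ax,u\rangle$. Smoothing. For $\mu>0$ let $f_\mu(x)=\max_{u\in\Omega_2}\langle Ax,u\rangle-\phi(u)-\mu\,\omega_+(u)$. It is differentiable with $\nabla f_\mu(x)=A^\top u_\mu(x)$, where $u_\mu(x)$ is the unique maximizer, and $\nabla f_\mu$ is Lipschitz with constant $L_\mu=\|A\|^2/\mu$. Update map. For $v,x\in\mathbb{R}^d$, $C>0$, $\lambda\ge0$: $\Pi^{C}_{v,\lambda g}(x)=\arg\min_{z\in\Omega_1}\frac{C}{2}\|z-x\|^2+\langle v,z\rangle+\lambda g(z)$. Inner method $\mathrm{APG}(x_0,t,L_\mu)$ (accelerated proximal gradient applied to $f_\mu+g$). Use either $\theta_k=\frac{2}{k+2}$, $\alpha_k=\frac{2}{k+1}$ for $k\ge0$, or $\alpha_0=\theta_0=1$ and $\alpha_{k+1}=\theta_{k+1}=\frac{\sqrt{\theta_k^4+4\theta_k^2}-\theta_k^2}{2}$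 for $k\ge0$ (these step sequences $\theta_k$ are unrelated to the exponent $\theta$). Set $z_0=x_0$, $V_{-1}=0$, $\Gamma_{-1}=0$. For $k=0,\dots,t-1$: $y_k=(1-\theta_k)x_k+\theta_kz_k$; $v_k=\nabla f_\mu(y_k)$; $V_k=V_{k-1}+v_k/\alpha_k$; $\Gamma_k=\Gamma_{k-1}+1/\alpha_k$; $z_{k+1}=\Pi^{L_\mu}_{V_k,\Gamma_kg}(x_0)$; $x_{k+1}=\Pi^{L_\mu}_{v_k,g}(y_k)$. Return $x_t$. HOPS. Input: number of stages $m$, iterations per stage $t$, initial point $x_0\in\Omega_1$, $b>1$. Set $\mu_1=\epsilon_0/(bD^2)$. For $s=1,\dots,m$: let $x_s=\mathrm{APG}(x_{s-1},t,L_{\mu_s})$ (with smoothing parameter $\mu_s$), then set $\mu_{s+1}=\mu_s/b$. Output $x_m$. *)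

theory Defs
  imports "HOL-Analysis.Analysis"
begin

definition is_norm :: "('v::real_vector \<Rightarrow> real) \<Rightarrow> bool" where
  "is_norm N \<longleftrightarrow>
     (\<forall>u. N u = 0 \<longleftrightarrow> u = 0) \<and>
     (\<forall>a u. N (a *\<^sub>R u) = \<bar>a\<bar> * N u) \<and>
     (\<forall>u v. N (u + v) \<le> N u + N v)"

definition strongly_convex_on ::
  "real \<Rightarrow> ('v::real_vector \<Rightarrow> real) \<Rightarrow> 'v set \<Rightarrow> ('v \<Rightarrow> real) \<Rightarrow> bool" where
  "strongly_convex_on \<sigma> N S h \<longleftrightarrow>
     convex S \<and>
     (\<forall>u\<in>S. \<forall>v\<in>S. \<forall>a\<in>{0..1}.
        h (a *\<^sub>R u + (1 - a) *\<^sub>R v)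
          \<le> a * h u + (1 - a) * h v - \<sigma> / 2 * a * (1 - a) * (N (u - v))\<^sup>2)"

definition op_norm :: "real^'d^'m \<Rightarrow> (real^'m \<Rightarrow> real) \<Rightarrow> real" where
  "op_norm A N = Sup {(A *v x) \<bullet> u | x u. norm x \<le> 1 \<and> N u \<le> 1}"

definition max_part ::
  "real^'d^'m \<Rightarrow> (real^'m) set \<Rightarrow> (real^'m \<Rightarrow> real) \<Rightarrow> real^'d \<Rightarrow> real" where
  "max_part A \<Omega>2 \<phi> x = (SUP u\<in>\<Omega>2. (A *v x) \<bullet> u - \<phi> u)"

definition smoothed ::
  "real^'d^'m \<Rightarrow> (real^'m) set \<Rightarrow> (real^'m \<Rightarrow> real) \<Rightarrow> (real^'m \<Rightarrow> real) \<Rightarrow> real \<Rightarrow> real^'d \<Rightarrow> real" where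
  "smoothed A \<Omega>2 \<phi> \<omega> \<mu> x = (SUP u\<in>\<Omega>2. (A *v x) \<bullet> u - \<phi> u - \<mu> * \<omega> u)"

definition minimizers :: "('v \<Rightarrow> real) \<Rightarrow> 'v set \<Rightarrow> 'v set" where
  "minimizers F S = {x. is_arg_min F (\<lambda>z. z \<in> S) x}"

(* Unspecified where h is not differentiable. *)
definition gradient :: "('v::real_inner \<Rightarrow> real) \<Rightarrow> 'v \<Rightarrow> 'v" where
  "gradient h x = (THE v. GDERIV h x :> v)"

(* The update map \<Pi>^C_{v, \<lambda> g}(x) over S.  For C > 0, \<lambda> \<ge> 0, g convex and
   S closed, convex and nonempty, the minimizer exists and is unique. *)
definition prox_map ::
  "('v::real_inner \<Rightarrow> real) \<Rightarrow> 'v set \<Rightarrow> real \<Rightarrow> 'v \<Rightarrow> real \<Rightarrow> 'v \<Rightarrow> 'v" where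
  "prox_map g S C v lam x =
     arg_min_on (\<lambda>z. C / 2 * (norm (z - x))\<^sup>2 + v \<bullet> z + lam * g z) S"

definition apg_step_sizes :: "(nat \<Rightarrow> real) \<Rightarrow> (nat \<Rightarrow> real) \<Rightarrow> bool" where
  "apg_step_sizes th al \<longleftrightarrow>
     (\<forall>k. th k = 2 / (real k + 2) \<and> al k = 2 / (real k + 1)) \<or>
     (th 0 = 1 \<and> al 0 = 1 \<and>
      (\<forall>k. th (Suc k) = (sqrt (th k ^ 4 + 4 * (th k)\<^sup>2) - (th k)\<^sup>2) / 2 \<and>
           al (Suc k) = th (Suc k)))"

(* State before inner iteration k = apg_iter: apg_x = x_k, apg_z = z_k,
   apg_V = V_{k-1}, apg_Gamma = \<Gamma>_{k-1}.  The index apg_iter is at the same time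
   the number of inner iterations executed so far. *)
record 'v apg_state =
  apg_iter :: nat
  apg_x :: 'v
  apg_z :: 'v
  apg_V :: 'v
  apg_Gamma :: real

definition apg_step ::
  "(nat \<Rightarrow> real) \<Rightarrow> (nat \<Rightarrow> real) \<Rightarrow> ('v::real_inner \<Rightarrow> 'v) \<Rightarrow> ('v \<Rightarrow> real) \<Rightarrow> 'v set
     \<Rightarrow> real \<Rightarrow> 'v \<Rightarrow> 'v apg_state \<Rightarrow> 'v apg_state" where
  "apg_step th al grad g S L x0 st =
     (let k = apg_iter st;
          y = (1 - th k) *\<^sub>R apg_x st + th k *\<^sub>R apg_z st;
          v = grad y;
          V = apg_V st + (1 / al k) *\<^sub>R v;
          \<Gamma> = apg_Gamma st + 1 / al k
      in \<lparr> apg_iter = Suc k,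
           apg_x = prox_map g S L v 1 y,
           apg_z = prox_map g S L V \<Gamma> x0,
           apg_V = V,
           apg_Gamma = \<Gamma> \<rparr>)"

(* Final state of APG(x0, t, L); the returned point is its apg_x component. *)
definition apg ::
  "(nat \<Rightarrow> real) \<Rightarrow> (nat \<Rightarrow> real) \<Rightarrow> ('v::real_inner \<Rightarrow> 'v) \<Rightarrow> ('v \<Rightarrow> real) \<Rightarrow> 'v set
     \<Rightarrow> 'v \<Rightarrow> nat \<Rightarrow> real \<Rightarrow> 'v apg_state" where
  "apg th al grad g S x0 t L =
     (apg_step th al grad g S L x0 ^^ t)
       \<lparr> apg_iter = 0, apg_x = x0, apg_z = x0, apg_V = 0, apg_Gamma = 0 \<rparr>"

(* State after s stages: hops_x = x_s, hops_mu = \<mu>_{s+1}; hops_iter is the number of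
   inner iterations executed over all these stages. *)
record 'v hops_state =
  hops_x :: 'v
  hops_mu :: real
  hops_iter :: nat

definition hops_stage ::
  "(nat \<Rightarrow> real) \<Rightarrow> (nat \<Rightarrow> real) \<Rightarrow> real^'d^'m \<Rightarrow> (real^'d) set \<Rightarrow> (real^'m) set
     \<Rightarrow> (real^'d \<Rightarrow> real) \<Rightarrow> (real^'m \<Rightarrow> real) \<Rightarrow> (real^'m \<Rightarrow> real) \<Rightarrow> (real^'m \<Rightarrow> real)
     \<Rightarrow> real \<Rightarrow> nat \<Rightarrow> (real^'d) hops_state \<Rightarrow> (real^'d) hops_state" where
  "hops_stage th al A \<Omega>1 \<Omega>2 g \<phi> \<omega> N b t st =
     (let \<mu> = hops_mu st;
          r = apg th al (gradient (smoothed A \<Omega>2 \<phi> \<omega> \<mu>)) g \<Omega>1 (hops_x st) t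
                ((op_norm A N)\<^sup>2 / \<mu>)
      in \<lparr> hops_x = apg_x r, hops_mu = \<mu> / b, hops_iter = hops_iter st + apg_iter r \<rparr>)"

definition hops ::
  "(nat \<Rightarrow> real) \<Rightarrow> (nat \<Rightarrow> real) \<Rightarrow> real^'d^'m \<Rightarrow> (real^'d) set \<Rightarrow> (real^'m) set
     \<Rightarrow> (real^'d \<Rightarrow> real) \<Rightarrow> (real^'m \<Rightarrow> real) \<Rightarrow> (real^'m \<Rightarrow> real) \<Rightarrow> (real^'m \<Rightarrow> real)
     \<Rightarrow> real \<Rightarrow> real \<Rightarrow> real \<Rightarrow> real^'d \<Rightarrow> nat \<Rightarrow> nat \<Rightarrow> (real^'d) hops_state" where
  "hops th al A \<Omega>1 \<Omega>2 g \<phi> \<omega> N D b \<epsilon>0 x0 m t =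
     (hops_stage th al A \<Omega>1 \<Omega>2 g \<phi> \<omega> N b t ^^ m)
       \<lparr> hops_x = x0, hops_mu = \<epsilon>0 / (b * D\<^sup>2), hops_iter = 0 \<rparr>"

end

(* The smoothed function f_mu lies above its linearizations and below them plus
   L_mu/2 times the squared distance; the second bound follows from the strong convexity of
   phi + mu * omega at the maximizer u_mu(y), without passing through the Lipschitz constant of
   the gradient. The two bounds determine the gradient and are all that the estimate sequence
   argument for APG uses. It gives, for every z in Omega_1,
     f_mu(x_t) + g(x_t) <= f_mu(z) + g(z) + 2 L_mu |z - x_0|^2 / t^2.
   Let delta = epsilon_0 / b^(s-1), so that stage s starts from F(x_{s-1}) - F_* <= delta + epsilon.
   By convexity and the error bound there is z with F(z) <= F_* + epsilon at distance at most
   c delta / epsilon^(1-theta) from x_{s-1}. With mu_s = delta / (b D^2), the smoothing error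
   mu_s D^2 / 2 and the APG error at z are each at most delta / (2b), so
   F(x_s) - F_* <= delta / b + epsilon. *)

theory Submission
  imports Defs
begin

section \<open>Strongly convex minimization and the update map\<close>

lemma strongly_convex_onD:
  assumes "strongly_convex_on \<sigma> N S h" "u \<in> S" "v \<in> S" "0 \<le> a" "a \<le> 1"
  shows "h (a *\<^sub>R u + (1 - a) *\<^sub>R v)
    \<le> a * h u + (1 - a) * h v - \<sigma> / 2 * a * (1 - a) * (N (u - v))\<^sup>2"
  using assms unfolding strongly_convex_on_def by simp

text \<open>Minimality of \<open>p\<close> is tested at
  \<open>(1 - s) *\<^sub>R z + s *\<^sub>R p\<close>; cancelling \<open>1 - s\<close> leaves a
  factor \<open>s\<close>, which tends to 1. Serves the update map with the Euclidean norm and the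
  dual maximizer with \<open>N\<close>.\<close>

lemma strongly_convex_on_minimum_growth:
  assumes h: "strongly_convex_on \<sigma> N S h"
    and p: "p \<in> S" "\<And>z. z \<in> S \<Longrightarrow> h p \<le> h z" and z: "z \<in> S"
  shows "h p + \<sigma> / 2 * (N (z - p))\<^sup>2 \<le> h z"
proof -
  have "\<sigma> / 2 * (N (z - p))\<^sup>2 \<le> h z - h p"
  proof (rule field_le_mult_one_interval)
    fix s :: real
    assume s: "0 < s" "s < 1"
    have "(1 - s) *\<^sub>R z + (1 - (1 - s)) *\<^sub>R p \<in> S"
      using h s z p unfolding strongly_convex_on_def by (intro convexD) auto
    then have "h p \<le> h ((1 - s) *\<^sub>R z + (1 - (1 - s)) *\<^sub>R p)"
      by (rule p(2))
    also have "\<dots> \<le> (1 - s) * h z + (1 - (1 - s)) * h p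
        - \<sigma> / 2 * (1 - s) * (1 - (1 - s)) * (N (z - p))\<^sup>2"
      using s by (intro strongly_convex_onD[OF h z p(1)]) auto
    finally have "(1 - s) * (s * (\<sigma> / 2 * (N (z - p))\<^sup>2)) \<le> (1 - s) * (h z - h p)"
      by (simp add: algebra_simps)
    then show "s * (\<sigma> / 2 * (N (z - p))\<^sup>2) \<le> h z - h p"
      using s by simp
  qed
  then show ?thesis by simp
qed

text \<open>Strong convexity forces quadratic growth away from any \<open>w\<close> in
  \<open>S\<close>, so values outside a large ball around \<open>w\<close> are at least
  \<open>h w\<close>, and a minimum over the compact part of \<open>S\<close> in that ball is
  global.\<close>

lemma strongly_convex_on_attains_inf:
  fixes S :: "'v::euclidean_space set"
  assumes h: "strongly_convex_on \<sigma> norm S h" and "\<sigma> > 0"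
    and S: "closed S" "S \<noteq> {}" and cont: "continuous_on S h"
  shows "\<exists>p\<in>S. \<forall>z\<in>S. h p \<le> h z"
proof -
  have attain: "\<exists>p\<in>S \<inter> cball w r. \<forall>z\<in>S \<inter> cball w r. h p \<le> h z"
    if "w \<in> S" "0 \<le> r" for w r
  proof (rule continuous_attains_inf)
    show "compact (S \<inter> cball w r)" using S by (simp add: closed_Int_compact)
    show "S \<inter> cball w r \<noteq> {}" using that by auto
    show "continuous_on (S \<inter> cball w r) h" using cont continuous_on_subset by blast
  qed
  obtain w where w: "w \<in> S" using S by blast
  obtain q where q: "q \<in> S" "\<And>z. z \<in> S \<inter> cball w 1 \<Longrightarrow> h q \<le> h z"
    using attain[OF w, of 1] by auto
  \<comment> \<open>\<open>R\<close> solves \<open>\<sigma> / 2 * (R - 1) = h w - h q\<close>: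
    beyond this radius the quadratic growth outweighs any descent possible within the unit
    ball.\<close>
  define R where "R = 1 + 2 / \<sigma> * (h w - h q)"
  have "h q \<le> h w" using q w by simp
  then have R: "1 \<le> R" using \<open>\<sigma> > 0\<close> by (simp add: R_def)
  have far: "h w \<le> h z" if z: "z \<in> S" "norm (z - w) > R" for z
  proof -
    define r where "r = norm (z - w)"
    have r: "r > 1" "r > R" using z R by (auto simp: r_def)
    \<comment> \<open>The point of the segment from \<open>w\<close> to \<open>z\<close> at distance
      1 from \<open>w\<close>, where \<open>h q\<close> is a lower bound.\<close>
    define y where "y = (1 / r) *\<^sub>R z + (1 - 1 / r) *\<^sub>R w"
    have "y \<in> S" unfolding y_def
      using h r z w unfolding strongly_convex_on_def by (intro convexD) auto
    moreover have "y - w = (1 / r) *\<^sub>R (z - w)" by (simp add: y_def algebra_simps)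
    then have "norm (y - w) = 1" using r by (auto simp: r_def)
    ultimately have "h q \<le> h y"
      by (intro q) (auto simp: dist_norm norm_minus_commute)
    also have "\<dots> \<le> 1 / r * h z + (1 - 1 / r) * h w - \<sigma> / 2 * (1 / r) * (1 - 1 / r) * r\<^sup>2"
      unfolding y_def r_def using r
      by (intro strongly_convex_onD[OF h z(1) w]) (simp_all add: r_def[symmetric])
    finally have "r * h q \<le> r * (1 / r * h z + (1 - 1 / r) * h w - \<sigma> / 2 * (1 / r) * (1 - 1 / r) * r\<^sup>2)"
      using r by (intro mult_left_mono) auto
    also have "\<dots> = h z + (r - 1) * h w - \<sigma> / 2 * (r - 1) * r"
      using r by (simp add: field_simps power2_eq_square)
    finally have "h w + r * (\<sigma> / 2 * (r - 1) - (h w - h q)) \<le> h z"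
      by (simp add: algebra_simps)
    moreover have "\<sigma> / 2 * (R - 1) = h w - h q" using \<open>\<sigma> > 0\<close> by (simp add: R_def)
    then have "h w - h q \<le> \<sigma> / 2 * (r - 1)"
      using r \<open>\<sigma> > 0\<close> by (smt (verit) half_gt_zero mult_left_mono)
    then have "0 \<le> r * (\<sigma> / 2 * (r - 1) - (h w - h q))" using r by simp
    ultimately show ?thesis by linarith
  qed
  obtain p where p: "p \<in> S" "\<And>z. z \<in> S \<inter> cball w R \<Longrightarrow> h p \<le> h z"
    using attain[OF w, of R] R by auto
  have "h p \<le> h w" using p w R by simp
  then have "h p \<le> h z" if "z \<in> S" for z
    using p(2)[of z] far[of z] that by (force simp: dist_norm norm_minus_commute)
  then show ?thesis using p by blast
qed

lemma power2_norm_convex_combination: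
  fixes u v :: "'v::real_inner"
  shows "(norm (a *\<^sub>R u + (1 - a) *\<^sub>R v - x))\<^sup>2
    = a * (norm (u - x))\<^sup>2 + (1 - a) * (norm (v - x))\<^sup>2 - a * (1 - a) * (norm (u - v))\<^sup>2"
  unfolding power2_norm_eq_inner
  by (simp add: inner_diff_left inner_diff_right inner_add_left inner_add_right
      inner_commute algebra_simps)

lemma strongly_convex_on_prox_objective:
  fixes g :: "'v::real_inner \<Rightarrow> real"
  assumes "convex S" "convex_on UNIV g" "lam \<ge> 0"
  shows "strongly_convex_on C norm S (\<lambda>z. C / 2 * (norm (z - x))\<^sup>2 + v \<bullet> z + lam * g z)"
  unfolding strongly_convex_on_def
proof (intro conjI ballI assms)
  fix p q :: 'v and a :: real
  assume a: "a \<in> {0..1}"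
  define K w where "K = C / 2" and "w = a *\<^sub>R p + (1 - a) *\<^sub>R q"
  have "lam * g w \<le> lam * (a * g p + (1 - a) * g q)"
    using assms a unfolding w_def by (intro mult_left_mono) (auto simp: convex_on_def)
  moreover have "v \<bullet> w = a * (v \<bullet> p) + (1 - a) * (v \<bullet> q)" by (simp add: w_def inner_add_right)
  moreover have "K * (norm (w - x))\<^sup>2
      = K * (a * (norm (p - x))\<^sup>2 + (1 - a) * (norm (q - x))\<^sup>2 - a * (1 - a) * (norm (p - q))\<^sup>2)"
    unfolding w_def power2_norm_convex_combination ..
  ultimately show "C / 2 * (norm (a *\<^sub>R p + (1 - a) *\<^sub>R q - x))\<^sup>2
      + v \<bullet> (a *\<^sub>R p + (1 - a) *\<^sub>R q) + lam * g (a *\<^sub>R p + (1 - a) *\<^sub>R q)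
    \<le> a * (C / 2 * (norm (p - x))\<^sup>2 + v \<bullet> p + lam * g p)
      + (1 - a) * (C / 2 * (norm (q - x))\<^sup>2 + v \<bullet> q + lam * g q)
      - C / 2 * a * (1 - a) * (norm (p - q))\<^sup>2"
    unfolding K_def[symmetric] w_def[symmetric] by (simp add: algebra_simps)
qed

text \<open>\<open>prox_map\<close> is a Hilbert choice, so existence of a minimizer comes first.
  The growth inequality then stands in for the first-order optimality condition of the
  update.\<close>

lemma prox_map_props:
  fixes g :: "'v::euclidean_space \<Rightarrow> real" and x v :: 'v
  assumes S: "closed S" "convex S" "S \<noteq> {}"
    and g: "convex_on UNIV g" and C: "C > 0" "lam \<ge> 0"
  defines "p \<equiv> prox_map g S C v lam x"
  shows prox_map_in: "p \<in> S"
    and prox_map_growth: "z \<in> S \<Longrightarrow>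
      C / 2 * (norm (p - x))\<^sup>2 + v \<bullet> p + lam * g p + C / 2 * (norm (z - p))\<^sup>2
        \<le> C / 2 * (norm (z - x))\<^sup>2 + v \<bullet> z + lam * g z"
proof -
  let ?q = "\<lambda>z. C / 2 * (norm (z - x))\<^sup>2 + v \<bullet> z + lam * g z"
  have q: "strongly_convex_on C norm S ?q"
    using S g C by (intro strongly_convex_on_prox_objective)
  have "continuous_on S g"
    using convex_on_continuous[OF open_UNIV g] continuous_on_subset by blast
  then have "continuous_on S ?q" by (intro continuous_intros)
  then obtain w where "w \<in> S" "\<forall>z\<in>S. ?q w \<le> ?q z"
    using strongly_convex_on_attains_inf[OF q C(1) S(1,3)] by blast
  then have "is_arg_min ?q (\<lambda>z. z \<in> S) w" by (auto simp: is_arg_min_def not_less)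
  then have "is_arg_min ?q (\<lambda>z. z \<in> S) p"
    unfolding p_def prox_map_def arg_min_on_def arg_min_def by (rule someI)
  then have p: "p \<in> S" "\<And>z. z \<in> S \<Longrightarrow> ?q p \<le> ?q z"
    by (auto simp: is_arg_min_def not_less)
  show "p \<in> S" by (rule p)
  show "?q p + C / 2 * (norm (z - p))\<^sup>2 \<le> ?q z" if "z \<in> S"
    using strongly_convex_on_minimum_growth[OF q p that] .
qed

section \<open>Smoothing\<close>

lemma is_normD:
  assumes "is_norm N"
  shows "N u = 0 \<longleftrightarrow> u = 0" "N (a *\<^sub>R u) = \<bar>a\<bar> * N u" "N (u + v) \<le> N u + N v"
  using assms by (auto simp: is_norm_def)

text \<open>\<open>N\<close> is convex, hence continuous, so it has a positive minimum on the
  Euclidean unit sphere; homogeneity does the rest.\<close>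

lemma is_norm_lower_bound:
  fixes N :: "'a::euclidean_space \<Rightarrow> real"
  assumes N: "is_norm N"
  obtains k where "k > 0" "\<And>u. k * norm u \<le> N u"
proof -
  have "convex_on UNIV N"
  proof (rule convex_onI)
    fix t :: real and x y
    assume "0 < t" "t < 1"
    then show "N ((1 - t) *\<^sub>R x + t *\<^sub>R y) \<le> (1 - t) * N x + t * N y"
      using is_normD(3)[OF N, of "(1 - t) *\<^sub>R x" "t *\<^sub>R y"] by (simp add: is_normD(2)[OF N])
  qed simp
  then have "continuous_on (sphere 0 1) N"
    using convex_on_continuous[OF open_UNIV] continuous_on_subset by blast
  then obtain w where w: "w \<in> sphere 0 1" "\<And>u. u \<in> sphere 0 1 \<Longrightarrow> N w \<le> N u"
    using continuous_attains_inf[of "sphere 0 (1::real)" N] by auto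
  have nonneg: "0 \<le> N u" for u
    using is_normD(3)[OF N, of u "-u"] is_normD(2)[OF N, of "-1" u] is_normD(1)[OF N, of 0]
    by simp
  have "w \<noteq> 0" using w(1) by auto
  then have "N w > 0" using nonneg[of w] is_normD(1)[OF N, of w] by simp
  moreover have "N w * norm u \<le> N u" for u
  proof (cases "u = 0")
    case True
    then show ?thesis using nonneg[of u] by simp
  next
    case False
    then have "N w \<le> N ((1 / norm u) *\<^sub>R u)" by (intro w) simp
    then show ?thesis using False by (simp add: is_normD(2)[OF N] field_simps)
  qed
  ultimately show ?thesis using that by blast
qed

lemma is_norm_pos:
  fixes N :: "'a::euclidean_space \<Rightarrow> real"
  assumes "is_norm N" "u \<noteq> 0"
  shows "0 < N u"
proof -
  obtain k where "k > 0" "k * norm u \<le> N u" using is_norm_lower_bound[OF assms(1)] by metis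
  then show ?thesis using assms(2) by (smt (verit) mult_pos_pos zero_less_norm_iff)
qed

text \<open>The lower bound on \<open>N\<close> bounds the set defining \<open>op_norm\<close>, so
  its \<open>Sup\<close> is an actual upper bound; scaling \<open>x\<close> and \<open>u\<close> to
  unit size gives the general case.\<close>

lemma inner_le_op_norm:
  fixes A :: "real^'d^'n"
  assumes N: "is_norm N"
  shows "(A *v x) \<bullet> u \<le> op_norm A N * norm x * N u"
proof -
  obtain k where k: "k > 0" "\<And>u. k * norm u \<le> N u" using is_norm_lower_bound[OF N] by metis
  have bound: "(A *v x) \<bullet> u \<le> onorm ((*v) A) * (1 / k)"
    if "norm x \<le> 1" "N u \<le> 1" for x :: "real^'d" and u
  proof -
    have "norm u \<le> 1 / k" using k(2)[of u] that(2) k(1) by (simp add: field_simps)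
    moreover have "norm (A *v x) \<le> onorm ((*v) A) * norm x"
      by (intro onorm matrix_vector_mul_bounded_linear)
    then have "norm (A *v x) \<le> onorm ((*v) A)"
      using mult_left_mono[OF that(1) onorm_pos_le[OF matrix_vector_mul_bounded_linear[of A]]]
      by linarith
    ultimately have "norm (A *v x) * norm u \<le> onorm ((*v) A) * (1 / k)"
      by (intro mult_mono onorm_pos_le matrix_vector_mul_bounded_linear) auto
    then show ?thesis using norm_cauchy_schwarz[of "A *v x" u] by linarith
  qed
  then have "bdd_above {(A *v x) \<bullet> u |x u. norm x \<le> 1 \<and> N u \<le> 1}"
    by (intro bdd_aboveI[where M = "onorm ((*v) A) * (1 / k)"]) blast
  then have unit: "(A *v x) \<bullet> u \<le> op_norm A N" if "norm x \<le> 1" "N u \<le> 1" for x u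
    unfolding op_norm_def using that by (intro cSup_upper) auto
  show ?thesis
  proof (cases "x = 0 \<or> u = 0")
    case True
    then show ?thesis using is_normD(1)[OF N, of 0] by auto
  next
    case False
    then have pos: "0 < norm x" "0 < N u" using is_norm_pos[OF N] by auto
    have "(A *v ((1 / norm x) *\<^sub>R x)) \<bullet> ((1 / N u) *\<^sub>R u) \<le> op_norm A N"
      using pos by (intro unit) (auto simp: is_normD(2)[OF N])
    then show ?thesis using pos
      by (simp add: matrix_vector_mult_scaleR field_simps)
  qed
qed

text \<open>Taking \<open>u = A *v x\<close> for some \<open>A *v x \<noteq> 0\<close> makes the
  left side of \<open>inner_le_op_norm\<close> positive. The constants \<open>L\<close> of the APG
  calls are therefore positive.\<close>

lemma op_norm_pos:
  fixes A :: "real^'d^'n"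
  assumes N: "is_norm N" and "A \<noteq> 0"
  shows "0 < op_norm A N"
proof -
  obtain x where x: "A *v x \<noteq> 0" using assms(2) matrix_eq[of A 0] by auto
  then have "0 < norm x * N (A *v x)" using is_norm_pos[OF N x] by (cases "x = 0") auto
  moreover have "0 < op_norm A N * (norm x * N (A *v x))"
    using x inner_le_op_norm[OF N, of A x "A *v x"]
    by (smt (verit) inner_gt_zero_iff mult.assoc)
  ultimately show ?thesis using zero_less_mult_pos2 by blast
qed

text \<open>The two bounds squeeze the difference quotient of the remainder between 0 and
  \<open>K * norm h\<close>; uniqueness of the derivative then settles the
  \<open>THE\<close>.\<close>

lemma gradient_eqI:
  assumes lower: "\<And>z. f y + v \<bullet> (z - y) \<le> f z"
    and upper: "\<And>z. f z \<le> f y + v \<bullet> (z - y) + K * (norm (z - y))\<^sup>2"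
  shows "gradient f y = v"
proof -
  have "((\<lambda>h. norm (f (y + h) - f y - h \<bullet> v) / norm h) \<longlongrightarrow> 0) (at 0)"
  proof (rule tendsto_sandwich[where f = "\<lambda>_. 0"])
    have "norm (f (y + h) - f y - h \<bullet> v) / norm h \<le> K * norm h" if "h \<noteq> 0" for h
      using lower[of "y + h"] upper[of "y + h"] that
      by (simp add: inner_commute divide_simps power2_eq_square algebra_simps)
    then show "\<forall>\<^sub>F h in at 0. norm (f (y + h) - f y - h \<bullet> v) / norm h \<le> K * norm h"
      by (auto simp: eventually_at_filter)
    show "((\<lambda>h::'a. K * norm h) \<longlongrightarrow> 0) (at 0)"
      by (auto intro!: tendsto_eq_intros)
  qed auto
  then have deriv: "GDERIV f y :> v"
    by (simp add: gderiv_def has_derivative_at bounded_linear_inner_left)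
  show ?thesis unfolding gradient_def
  proof (rule the_equality[where P = "\<lambda>v. GDERIV f y :> v", OF deriv])
    fix w
    assume "GDERIV f y :> w"
    then have "(\<lambda>h. h \<bullet> w) = (\<lambda>h. h \<bullet> v)"
      using deriv has_derivative_unique unfolding gderiv_def by blast
    then show "w = v" by (metis vector_eq_ldot)
  qed
qed

lemma strongly_convex_on_convex_plus_scaled:
  assumes "strongly_convex_on 1 N S \<omega>" "convex_on UNIV \<phi>" "\<mu> \<ge> 0"
  shows "strongly_convex_on \<mu> N S (\<lambda>u. \<phi> u + \<mu> * \<omega> u)"
  unfolding strongly_convex_on_def
proof (intro conjI ballI)
  show "convex S" using assms(1) by (simp add: strongly_convex_on_def)
  fix u v and a :: real
  assume *: "u \<in> S" "v \<in> S" "a \<in> {0..1}"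
  then have "\<mu> * \<omega> (a *\<^sub>R u + (1 - a) *\<^sub>R v)
      \<le> \<mu> * (a * \<omega> u + (1 - a) * \<omega> v - 1 / 2 * a * (1 - a) * (N (u - v))\<^sup>2)"
    using assms by (intro mult_left_mono strongly_convex_onD) auto
  moreover have "\<phi> (a *\<^sub>R u + (1 - a) *\<^sub>R v) \<le> a * \<phi> u + (1 - a) * \<phi> v"
    using assms(2) * by (auto simp: convex_on_def)
  ultimately show "\<phi> (a *\<^sub>R u + (1 - a) *\<^sub>R v) + \<mu> * \<omega> (a *\<^sub>R u + (1 - a) *\<^sub>R v)
    \<le> a * (\<phi> u + \<mu> * \<omega> u) + (1 - a) * (\<phi> v + \<mu> * \<omega> v)
      - \<mu> / 2 * a * (1 - a) * (N (u - v))\<^sup>2"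
    by (simp add: algebra_simps)
qed

lemma conjugate_attained:
  fixes h :: "'v::real_inner \<Rightarrow> real"
  assumes "compact K" "K \<noteq> {}" "continuous_on K h"
  obtains u where "u \<in> K" "(SUP u\<in>K. w \<bullet> u - h u) = w \<bullet> u - h u"
    "\<And>v. v \<in> K \<Longrightarrow> w \<bullet> v - h v \<le> w \<bullet> u - h u"
proof -
  have "continuous_on K (\<lambda>u. w \<bullet> u - h u)" using assms by (intro continuous_intros)
  then obtain u where "u \<in> K" "\<And>v. v \<in> K \<Longrightarrow> w \<bullet> v - h v \<le> w \<bullet> u - h u"
    using continuous_attains_sup[OF assms(1,2), of "\<lambda>u. w \<bullet> u - h u"] by blast
  moreover from this have "(SUP u\<in>K. w \<bullet> u - h u) = w \<bullet> u - h u"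
    by (intro cSup_eq_maximum) auto
  ultimately show ?thesis using that by blast
qed

section \<open>The smoothed maximum: attainment, approximation error, gradient bounds\<close>

locale smoothing =
  fixes A :: "real^'d^'n" and \<Omega>2 :: "(real^'n) set" and \<phi> \<omega> N :: "real^'n \<Rightarrow> real" and D :: real
  assumes compact: "compact \<Omega>2" and nonempty: "\<Omega>2 \<noteq> {}"
    and \<phi>: "convex_on UNIV \<phi>" and N: "is_norm N"
    and \<omega>_nonneg: "\<And>u. u \<in> \<Omega>2 \<Longrightarrow> 0 \<le> \<omega> u" and \<omega>_cont: "continuous_on \<Omega>2 \<omega>"
    and \<omega>_convex: "strongly_convex_on 1 N \<Omega>2 \<omega>"
    and D: "(SUP u\<in>\<Omega>2. \<omega> u) \<le> D\<^sup>2 / 2"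
begin

lemma \<phi>_cont: "continuous_on \<Omega>2 \<phi>"
  using convex_on_continuous[OF open_UNIV \<phi>] continuous_on_subset by blast

lemma \<omega>_le: "u \<in> \<Omega>2 \<Longrightarrow> \<omega> u \<le> D\<^sup>2 / 2"
proof -
  assume "u \<in> \<Omega>2"
  moreover have "bdd_above (\<omega> ` \<Omega>2)"
    using compact_continuous_image[OF \<omega>_cont compact] by (intro bounded_imp_bdd_above compact_imp_bounded)
  ultimately have "\<omega> u \<le> (SUP u\<in>\<Omega>2. \<omega> u)" by (rule cSUP_upper)
  then show ?thesis using D by simp
qed

lemma smoothed_attained:
  obtains u where "u \<in> \<Omega>2"
    "smoothed A \<Omega>2 \<phi> \<omega> \<mu> x = (A *v x) \<bullet> u - (\<phi> u + \<mu> * \<omega> u)"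
    "\<And>v. v \<in> \<Omega>2 \<Longrightarrow> (A *v x) \<bullet> v - (\<phi> v + \<mu> * \<omega> v) \<le> (A *v x) \<bullet> u - (\<phi> u + \<mu> * \<omega> u)"
proof -
  have "continuous_on \<Omega>2 (\<lambda>u. \<phi> u + \<mu> * \<omega> u)"
    using \<phi>_cont \<omega>_cont by (intro continuous_intros)
  then show ?thesis
    by (rule conjugate_attained[OF compact nonempty, of _ "A *v x"], intro that)
      (simp_all add: smoothed_def diff_diff_eq)
qed

lemma le_smoothed:
  assumes "u \<in> \<Omega>2"
  shows "(A *v x) \<bullet> u - (\<phi> u + \<mu> * \<omega> u) \<le> smoothed A \<Omega>2 \<phi> \<omega> \<mu> x"
  by (rule smoothed_attained[of \<mu> x]) (simp add: assms)

text \<open>Parameter 0 carries the attainment facts over to the unsmoothed maximum.\<close>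

lemma max_part_eq_smoothed: "max_part A \<Omega>2 \<phi> = smoothed A \<Omega>2 \<phi> \<omega> 0"
  by (simp add: fun_eq_iff max_part_def smoothed_def)

lemma smoothed_le_max_part:
  assumes "\<mu> \<ge> 0"
  shows "smoothed A \<Omega>2 \<phi> \<omega> \<mu> x \<le> max_part A \<Omega>2 \<phi> x"
proof -
  obtain u where u: "u \<in> \<Omega>2"
    "smoothed A \<Omega>2 \<phi> \<omega> \<mu> x = (A *v x) \<bullet> u - (\<phi> u + \<mu> * \<omega> u)"
    using smoothed_attained by metis
  show ?thesis
    using le_smoothed[OF u(1), of x 0] u(2) mult_nonneg_nonneg[OF assms \<omega>_nonneg[OF u(1)]]
    by (simp add: max_part_eq_smoothed)
qed

text \<open>The maximizer for parameter 0 is a competitor for parameter \<open>\<mu>\<close> and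
  loses only \<open>\<mu> * \<omega> u\<close> there.\<close>

lemma max_part_le_smoothed:
  assumes "\<mu> \<ge> 0"
  shows "max_part A \<Omega>2 \<phi> x \<le> smoothed A \<Omega>2 \<phi> \<omega> \<mu> x + \<mu> * D\<^sup>2 / 2"
proof -
  obtain u where u: "u \<in> \<Omega>2" "max_part A \<Omega>2 \<phi> x = (A *v x) \<bullet> u - (\<phi> u + 0 * \<omega> u)"
    unfolding max_part_eq_smoothed using smoothed_attained by metis
  show ?thesis
    using le_smoothed[OF u(1), of x \<mu>] u(2) mult_left_mono[OF \<omega>_le[OF u(1)] assms] by simp
qed

lemma convex_max_part: "convex_on UNIV (max_part A \<Omega>2 \<phi>)"
proof (rule convex_onI)
  fix t :: real and x y
  assume t: "0 < t" "t < 1"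
  obtain u where u: "u \<in> \<Omega>2" "max_part A \<Omega>2 \<phi> ((1 - t) *\<^sub>R x + t *\<^sub>R y)
      = (A *v ((1 - t) *\<^sub>R x + t *\<^sub>R y)) \<bullet> u - (\<phi> u + 0 * \<omega> u)"
    unfolding max_part_eq_smoothed using smoothed_attained by metis
  have "(1 - t) * ((A *v x) \<bullet> u - \<phi> u) \<le> (1 - t) * max_part A \<Omega>2 \<phi> x"
       "t * ((A *v y) \<bullet> u - \<phi> u) \<le> t * max_part A \<Omega>2 \<phi> y"
    using t le_smoothed[OF u(1), of x 0] le_smoothed[OF u(1), of y 0]
    by (auto simp: max_part_eq_smoothed)
  then show "max_part A \<Omega>2 \<phi> ((1 - t) *\<^sub>R x + t *\<^sub>R y)
      \<le> (1 - t) * max_part A \<Omega>2 \<phi> x + t * max_part A \<Omega>2 \<phi> y"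
    unfolding u(2) by (simp add: matrix_vector_right_distrib matrix_vector_mult_scaleR
        inner_add_left algebra_simps)
qed simp

lemma smoothed_gradient_bounds:
  assumes \<mu>: "\<mu> > 0"
  defines "f \<equiv> smoothed A \<Omega>2 \<phi> \<omega> \<mu>"
  shows smoothed_ge_linearization: "f y + gradient f y \<bullet> (z - y) \<le> f z"
    and smoothed_descent:
      "f z \<le> f y + gradient f y \<bullet> (z - y) + ((op_norm A N)\<^sup>2 / \<mu>) / 2 * (norm (z - y))\<^sup>2"
proof -
  let ?h = "\<lambda>u. \<phi> u + \<mu> * \<omega> u"
  obtain u where u: "u \<in> \<Omega>2" "f y = (A *v y) \<bullet> u - ?h u"
      "\<And>v. v \<in> \<Omega>2 \<Longrightarrow> (A *v y) \<bullet> v - ?h v \<le> (A *v y) \<bullet> u - ?h u"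
    unfolding f_def using smoothed_attained[of \<mu> y] by metis
  \<comment> \<open>\<open>u v* A\<close> is the transpose of \<open>A\<close> applied to the
    maximizer at \<open>y\<close>; both bounds are proved for this candidate before it is identified
    with \<open>gradient f y\<close>.\<close>
  have inner_eq: "(u v* A) \<bullet> z = (A *v z) \<bullet> u" for z
    by (metis dot_lmul_matrix inner_commute)
  have lower: "f y + (u v* A) \<bullet> (z - y) \<le> f z" for z
    using le_smoothed[OF u(1), of z \<mu>] u(2)
    by (simp add: inner_eq f_def matrix_vector_mult_diff_distrib inner_diff_left)
  have upper: "f z \<le> f y + (u v* A) \<bullet> (z - y) + ((op_norm A N)\<^sup>2 / \<mu>) / 2 * (norm (z - y))\<^sup>2" for z
  proof -
    obtain w where w: "w \<in> \<Omega>2" "f z = (A *v z) \<bullet> w - ?h w"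
      unfolding f_def using smoothed_attained[of \<mu> z] by metis
    have "strongly_convex_on \<mu> N \<Omega>2 ?h"
      using \<omega>_convex \<phi> \<mu> by (intro strongly_convex_on_convex_plus_scaled) auto
    then have "strongly_convex_on \<mu> N \<Omega>2 (\<lambda>v. ?h v - (A *v y) \<bullet> v)"
      by (simp add: strongly_convex_on_def inner_add_right algebra_simps)
    from strongly_convex_on_minimum_growth[OF this u(1) _ w(1)] u(3)
    have growth: "?h u - (A *v y) \<bullet> u + \<mu> / 2 * (N (w - u))\<^sup>2 \<le> ?h w - (A *v y) \<bullet> w"
      by fastforce
    have "(A *v (z - y)) \<bullet> (w - u) \<le> op_norm A N * norm (z - y) * N (w - u)"
      by (rule inner_le_op_norm[OF N])
    \<comment> \<open>Young's inequality weighted by \<open>\<mu>\<close>, so that the term in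
      \<open>w - u\<close> is exactly what \<open>growth\<close> provides.\<close>
    also have "\<dots> \<le> ((op_norm A N)\<^sup>2 / \<mu>) / 2 * (norm (z - y))\<^sup>2 + \<mu> / 2 * (N (w - u))\<^sup>2"
    proof -
      have "0 \<le> (op_norm A N * norm (z - y) - \<mu> * N (w - u))\<^sup>2 / (2 * \<mu>)" using \<mu> by simp
      also have "\<dots> = ((op_norm A N)\<^sup>2 / \<mu>) / 2 * (norm (z - y))\<^sup>2 + \<mu> / 2 * (N (w - u))\<^sup>2
          - op_norm A N * norm (z - y) * N (w - u)"
        using \<mu> by (simp add: field_simps power2_eq_square)
      finally show ?thesis by simp
    qed
    finally show ?thesis using growth w(2) u(2)
      by (simp add: inner_eq matrix_vector_mult_diff_distrib inner_diff_left inner_diff_right)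
  qed
  have "gradient f y = u v* A" by (rule gradient_eqI[OF lower upper])
  then show "f y + gradient f y \<bullet> (z - y) \<le> f z"
    "f z \<le> f y + gradient f y \<bullet> (z - y) + ((op_norm A N)\<^sup>2 / \<mu>) / 2 * (norm (z - y))\<^sup>2"
    using lower upper by auto
qed

end

section \<open>Accelerated proximal gradient\<close>

text \<open>The formula picks the positive root of \<open>r^2 = (1 - r) * q^2\<close>. In
  reciprocals this telescopes, so that for the second step rule the weights up to step k sum to the
  square of the last one.\<close>

lemma apg_step_size_root:
  fixes q r :: real
  assumes q: "q > 0" and r: "r = (sqrt (q ^ 4 + 4 * q\<^sup>2) - q\<^sup>2) / 2"
  shows "r > 0" "(1 / r)\<^sup>2 = (1 / q)\<^sup>2 + 1 / r"
proof -
  define s where "s = sqrt (q ^ 4 + 4 * q\<^sup>2)"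
  have s2: "s\<^sup>2 = q ^ 4 + 4 * q\<^sup>2" by (simp add: s_def)
  have "q\<^sup>2 < s" unfolding s_def using q by (intro real_less_rsqrt) simp
  then show "r > 0" unfolding r s_def[symmetric] by simp
  have "s = 2 * r + q\<^sup>2" using r by (simp add: s_def)
  then have "r\<^sup>2 = (1 - r) * q\<^sup>2" using s2 by (simp add: power2_eq_square power4_eq_xxxx algebra_simps)
  then show "(1 / r)\<^sup>2 = (1 / q)\<^sup>2 + 1 / r"
    using \<open>r > 0\<close> q by (simp add: field_simps power2_eq_square)
qed

text \<open>\<open>G k\<close> is the weight \<open>\<Gamma>\<close> with index \<open>k - 1\<close>; both step rules satisfy \<open>\<theta>\<^sub>k = (1 / \<alpha>\<^sub>k) / G (Suc k)\<close>, which is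
  all that the estimate sequence argument needs besides the two inequalities.\<close>

lemma apg_step_sizes_props:
  assumes "apg_step_sizes th al"
  defines "G \<equiv> \<lambda>k. \<Sum>i<k. 1 / al i"
  shows apg_step_sizes_pos: "al k > 0"
    and apg_step_sizes_weight: "th k * G (Suc k) = 1 / al k"
    and apg_step_sizes_square: "(1 / al k)\<^sup>2 \<le> G (Suc k)"
    and apg_step_sizes_growth: "(real k)\<^sup>2 / 4 \<le> G k"
proof -
  have "al k > 0 \<and> th k * G (Suc k) = 1 / al k \<and> (1 / al k)\<^sup>2 \<le> G (Suc k) \<and> (real k)\<^sup>2 / 4 \<le> G k"
    using assms(1) unfolding apg_step_sizes_def
  proof (elim disjE conjE)
    assume *: "\<forall>k. th k = 2 / (real k + 2) \<and> al k = 2 / (real k + 1)"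
    have G: "G k = real k * (real k + 1) / 4" for k
      by (induction k) (auto simp: G_def * field_simps)
    have k: "th k = 2 / (real k + 2)" "al k = 2 / (real k + 1)" using * by auto
    show ?thesis unfolding G k by (simp add: field_simps power2_eq_square)
  next
    assume *: "th 0 = 1" "al 0 = 1"
      "\<forall>k. th (Suc k) = (sqrt (th k ^ 4 + 4 * (th k)\<^sup>2) - (th k)\<^sup>2) / 2 \<and> al (Suc k) = th (Suc k)"
    have al: "al k = th k" for k using * by (cases k) auto
    have th: "0 < th k \<and> G (Suc k) = (1 / th k)\<^sup>2 \<and> (real k + 2) / 2 \<le> 1 / th k" for k
    proof (induction k)
      case 0
      then show ?case using * by (simp add: G_def)
    next
      case (Suc k)
      then have pos: "0 < th k" by simp
      have "th (Suc k) = (sqrt (th k ^ 4 + 4 * (th k)\<^sup>2) - (th k)\<^sup>2) / 2" using * by simp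
      note root = apg_step_size_root[OF pos this]
      \<comment> \<open>By the root equation the right side is \<open>(1 / th k)^2 + 1 / 4\<close>;
        taking roots, the reciprocals grow by at least 1/2 per step.\<close>
      have "(1 / th k)\<^sup>2 \<le> (1 / th (Suc k) - 1 / 2)\<^sup>2"
        using root(2) by (simp add: power2_diff)
      moreover have "0 \<le> 1 / th (Suc k) - 1 / 2"
      proof (rule ccontr)
        \<comment> \<open>A reciprocal below 1/2 would exceed its own square, against the root
          equation.\<close>
        assume "\<not> ?thesis"
        then have "1 / th (Suc k) * (1 / th (Suc k)) \<le> 1 / 2 * (1 / th (Suc k))"
          using root(1) by (intro mult_right_mono) auto
        then have "(1 / th (Suc k))\<^sup>2 \<le> 1 / 2 * (1 / th (Suc k))"
          by (simp only: power2_eq_square)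
        moreover have "1 / th (Suc k) > 0" using root(1) by simp
        ultimately show False using root(2) zero_le_power2[of "1 / th k"] by linarith
      qed
      ultimately have "1 / th k \<le> 1 / th (Suc k) - 1 / 2" by (rule power2_le_imp_le)
      moreover have "G (Suc (Suc k)) = G (Suc k) + 1 / th (Suc k)" by (simp add: G_def al)
      ultimately show ?case using Suc root by auto
    qed
    have "(real k)\<^sup>2 / 4 \<le> G k"
    proof (cases k)
      case 0
      then show ?thesis by (simp add: G_def)
    next
      case (Suc j)
      \<comment> \<open>\<open>G (Suc j)\<close> is the square of \<open>1 / th j\<close>: the
        weight index runs one ahead of the step index.\<close>
      have "((real j + 2) / 2)\<^sup>2 \<le> G (Suc j)" using th[of j]
        by (metis power_mono add_nonneg_nonneg of_nat_0_le_iff zero_le_divide_iff zero_le_numeral)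
      moreover have "(real k)\<^sup>2 / 4 \<le> ((real j + 2) / 2)\<^sup>2"
        using Suc by (simp add: power_divide power2_eq_square algebra_simps)
      ultimately show ?thesis using Suc by simp
    qed
    then show ?thesis using th[of k] al[of k] by (simp add: power2_eq_square)
  qed
  then show "al k > 0" "th k * G (Suc k) = 1 / al k" "(1 / al k)\<^sup>2 \<le> G (Suc k)"
    "(real k)\<^sup>2 / 4 \<le> G k" by auto
qed

section \<open>Estimate sequences for a composite objective\<close>

locale composite_problem =
  fixes S :: "'v::euclidean_space set" and f g :: "'v \<Rightarrow> real" and grad :: "'v \<Rightarrow> 'v"
    and L :: real and x0 :: 'v
  assumes S: "closed S" "convex S" and x0: "x0 \<in> S" and g: "convex_on UNIV g" and L: "L > 0"
    and linearization: "f y + grad y \<bullet> (z - y) \<le> f z"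
    and descent: "f z \<le> f y + grad y \<bullet> (z - y) + L / 2 * (norm (z - y))\<^sup>2"
begin

text \<open>The estimate function \<open>L/2 \<parallel>z - x0\<parallel>\<^sup>2 + V \<bullet> z + \<Gamma> g(z) + e\<close>, minimized over \<open>S\<close> at \<open>z\<^sub>k\<close>,
  stays above \<open>\<Gamma>\<close> times the objective value at \<open>x\<^sub>k\<close>.\<close>

lemma estimate_sequence_step:
  fixes x zk V :: 'v and \<Gamma> a \<tau> e :: real
  assumes x: "x \<in> S" and \<Gamma>: "0 \<le> \<Gamma>" and a: "0 < a" "a\<^sup>2 \<le> \<Gamma> + a" "\<tau> * (\<Gamma> + a) = a"
    and prev: "\<And>z. z \<in> S \<Longrightarrow> \<Gamma> * (f x + g x) + L / 2 * (norm (z - zk))\<^sup>2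
      \<le> L / 2 * (norm (z - x0))\<^sup>2 + V \<bullet> z + \<Gamma> * g z + e"
  defines "y \<equiv> (1 - \<tau>) *\<^sub>R x + \<tau> *\<^sub>R zk"
  defines "V' \<equiv> V + a *\<^sub>R grad y"
  defines "z' \<equiv> prox_map g S L V' (\<Gamma> + a) x0" and "x' \<equiv> prox_map g S L (grad y) 1 y"
  assumes z: "z \<in> S"
  shows "(\<Gamma> + a) * (f x' + g x') + L / 2 * (norm (z - z'))\<^sup>2
      \<le> L / 2 * (norm (z - x0))\<^sup>2 + V' \<bullet> z + (\<Gamma> + a) * g z + (e + a * (f y - grad y \<bullet> y))"
proof -
  define l where "l u = f y + grad y \<bullet> (u - y)" for u
  \<comment> \<open>The trial point for the proximal step: \<open>y\<close> with \<open>zk\<close>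
    replaced by the new \<open>z'\<close>, so that \<open>w - y\<close> is \<open>\<tau>\<close>
    times \<open>z' - zk\<close>.\<close>
  define w where "w = (1 - \<tau>) *\<^sub>R x + \<tau> *\<^sub>R z'"
  have ne: "S \<noteq> {}" using x by blast
  have \<Gamma>': "0 < \<Gamma> + a" using \<Gamma> a by simp
  have \<tau>: "\<tau> = a / (\<Gamma> + a)" using a \<Gamma>' by (simp add: field_simps)
  have \<tau>01: "0 \<le> \<tau>" "\<tau> \<le> 1" unfolding \<tau> using \<Gamma> a by auto
  have weights: "(\<Gamma> + a) * (1 - \<tau>) = \<Gamma>" "(\<Gamma> + a) * \<tau> = a" using a(3) by (auto simp: algebra_simps)
  have z'S: "z' \<in> S" unfolding z'_def using S ne g L \<Gamma>' by (intro prox_map_in) auto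
  have wS: "w \<in> S" unfolding w_def using S x z'S \<tau>01 by (intro convexD) auto
  have z'_growth: "L / 2 * (norm (z' - x0))\<^sup>2 + V' \<bullet> z' + (\<Gamma> + a) * g z' + L / 2 * (norm (z - z'))\<^sup>2
      \<le> L / 2 * (norm (z - x0))\<^sup>2 + V' \<bullet> z + (\<Gamma> + a) * g z"
    unfolding z'_def using S ne g L \<Gamma>' z by (intro prox_map_growth) auto
  have "L / 2 * (norm (x' - y))\<^sup>2 + grad y \<bullet> x' + 1 * g x' + L / 2 * (norm (w - x'))\<^sup>2
      \<le> L / 2 * (norm (w - y))\<^sup>2 + grad y \<bullet> w + 1 * g w"
    unfolding x'_def using S ne g L wS by (intro prox_map_growth) auto
  moreover have "0 \<le> L / 2 * (norm (w - x'))\<^sup>2" using L by simp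
  ultimately have "l x' + L / 2 * (norm (x' - y))\<^sup>2 + g x' \<le> l w + L / 2 * (norm (w - y))\<^sup>2 + g w"
    by (simp add: l_def inner_diff_right)
  then have "f x' + g x' \<le> l w + g w + L / 2 * (norm (w - y))\<^sup>2"
    using descent[of x' y] by (simp add: l_def)
  then have "(\<Gamma> + a) * (f x' + g x') \<le> (\<Gamma> + a) * (l w + g w + L / 2 * (norm (w - y))\<^sup>2)"
    using \<Gamma>' by (intro mult_left_mono) auto
  also have "\<dots> = (\<Gamma> + a) * l w + (\<Gamma> + a) * g w + (\<Gamma> + a) * (L / 2 * (norm (w - y))\<^sup>2)"
    by (simp add: algebra_simps)
  also have "(\<Gamma> + a) * l w = \<Gamma> * l x + a * l z'"
  proof -
    have "l w = (1 - \<tau>) * l x + \<tau> * l z'"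
      by (simp add: l_def w_def inner_add_right inner_diff_right algebra_simps)
    then have "(\<Gamma> + a) * l w = ((\<Gamma> + a) * (1 - \<tau>)) * l x + ((\<Gamma> + a) * \<tau>) * l z'"
      by (simp add: distrib_left mult.assoc)
    then show ?thesis unfolding weights .
  qed
  also have "(\<Gamma> + a) * g w \<le> \<Gamma> * g x + a * g z'"
  proof -
    have "g w \<le> (1 - \<tau>) * g x + \<tau> * g z'"
      unfolding w_def using g \<tau>01 by (intro convex_onD) auto
    then have "(\<Gamma> + a) * g w \<le> (\<Gamma> + a) * ((1 - \<tau>) * g x + \<tau> * g z')"
      using \<Gamma>' by (intro mult_left_mono) auto
    also have "\<dots> = ((\<Gamma> + a) * (1 - \<tau>)) * g x + ((\<Gamma> + a) * \<tau>) * g z'"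
      by (simp add: distrib_left mult.assoc)
    finally show ?thesis unfolding weights .
  qed
  \<comment> \<open>The condition \<open>a^2 \<le> \<Gamma> + a\<close> enters here: it bounds the
    factor of the squared distance by 1, so that the quadratic term of \<open>prev\<close> can
    absorb it.\<close>
  also have "(\<Gamma> + a) * (L / 2 * (norm (w - y))\<^sup>2) \<le> L / 2 * (norm (z' - zk))\<^sup>2"
  proof -
    have "w - y = \<tau> *\<^sub>R (z' - zk)" by (simp add: w_def y_def algebra_simps)
    then have "(\<Gamma> + a) * (L / 2 * (norm (w - y))\<^sup>2)
        = ((\<Gamma> + a) * \<tau>) * \<tau> * (L / 2 * (norm (z' - zk))\<^sup>2)"
      by (simp add: power_mult_distrib power2_eq_square)
    also have "((\<Gamma> + a) * \<tau>) * \<tau> \<le> 1"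
      unfolding weights using \<tau> a(2) \<Gamma>' by (simp add: power2_eq_square)
    finally show ?thesis using L by (simp add: mult_left_le_one_le mult_right_mono)
  qed
  also have "\<Gamma> * l x \<le> \<Gamma> * f x"
    using linearization[of y x] \<Gamma> by (intro mult_left_mono) (auto simp: l_def)
  finally have "(\<Gamma> + a) * (f x' + g x')
      \<le> \<Gamma> * (f x + g x) + L / 2 * (norm (z' - zk))\<^sup>2 + a * l z' + a * g z'"
    by (simp add: algebra_simps)
  \<comment> \<open>\<open>prev\<close> is applied at \<open>z'\<close>; the growth of the new
    estimate function around its minimizer \<open>z'\<close> then supplies the term in
    \<open>z\<close>.\<close>
  then show ?thesis using prev[OF z'S] z'_growth
    by (simp add: V'_def l_def inner_add_left inner_diff_right algebra_simps)
qed

text \<open>The state does not store the constant terms of the linearizations, so \<open>e\<close>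
  collects them: \<open>V \<bullet> z + e\<close> is the weighted sum of the linear lower bounds of
  \<open>f\<close> built so far.\<close>

lemma apg_invariant:
  assumes sizes: "apg_step_sizes th al"
  defines "st \<equiv> \<lambda>t. apg th al grad g S x0 t L"
  shows "apg_iter (st t) = t \<and> apg_x (st t) \<in> S \<and> apg_Gamma (st t) = (\<Sum>i<t. 1 / al i) \<and>
    (\<exists>e. (\<forall>z\<in>S. apg_Gamma (st t) * (f (apg_x (st t)) + g (apg_x (st t)))
              + L / 2 * (norm (z - apg_z (st t)))\<^sup>2
            \<le> L / 2 * (norm (z - x0))\<^sup>2 + apg_V (st t) \<bullet> z + apg_Gamma (st t) * g z + e) \<and>
         (\<forall>z. apg_V (st t) \<bullet> z + e \<le> apg_Gamma (st t) * f z))"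
proof (induction t)
  case 0
  show ?case unfolding st_def apg_def by (auto simp: x0 intro!: exI[of _ 0])
next
  case (Suc t)
  then obtain e where IH: "apg_iter (st t) = t" "apg_x (st t) \<in> S"
    "apg_Gamma (st t) = (\<Sum>i<t. 1 / al i)"
    "\<And>z. z \<in> S \<Longrightarrow> apg_Gamma (st t) * (f (apg_x (st t)) + g (apg_x (st t)))
              + L / 2 * (norm (z - apg_z (st t)))\<^sup>2
            \<le> L / 2 * (norm (z - x0))\<^sup>2 + apg_V (st t) \<bullet> z + apg_Gamma (st t) * g z + e"
    "\<And>z. apg_V (st t) \<bullet> z + e \<le> apg_Gamma (st t) * f z" by blast
  define y where "y = (1 - th t) *\<^sub>R apg_x (st t) + th t *\<^sub>R apg_z (st t)"
  define V where "V = apg_V (st t) + (1 / al t) *\<^sub>R grad y"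
  have "st (Suc t) = apg_step th al grad g S L x0 (st t)" by (simp add: st_def apg_def)
  then have st: "apg_iter (st (Suc t)) = Suc t" "apg_V (st (Suc t)) = V"
    "apg_Gamma (st (Suc t)) = apg_Gamma (st t) + 1 / al t"
    "apg_x (st (Suc t)) = prox_map g S L (grad y) 1 y"
    "apg_z (st (Suc t)) = prox_map g S L V (apg_Gamma (st t) + 1 / al t) x0"
    by (simp_all add: apg_step_def Let_def IH(1) y_def V_def)
  have al: "1 / al i > 0" for i using apg_step_sizes_pos[OF sizes] by simp
  have \<Gamma>: "apg_Gamma (st t) \<ge> 0" unfolding IH(3) using al by (simp add: sum_nonneg less_imp_le)
  have "prox_map g S L (grad y) 1 y \<in> S" using S x0 g L by (intro prox_map_in) auto
  moreover have "(apg_Gamma (st t) + 1 / al t) * (f (apg_x (st (Suc t))) + g (apg_x (st (Suc t))))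
              + L / 2 * (norm (z - apg_z (st (Suc t))))\<^sup>2
            \<le> L / 2 * (norm (z - x0))\<^sup>2 + V \<bullet> z + (apg_Gamma (st t) + 1 / al t) * g z
              + (e + 1 / al t * (f y - grad y \<bullet> y))" if "z \<in> S" for z
    unfolding st V_def y_def
    using apg_step_sizes_square[OF sizes, of t] apg_step_sizes_weight[OF sizes, of t] IH(3) that
    by (intro estimate_sequence_step[OF IH(2) \<Gamma> al _ _ IH(4)]) simp_all
  moreover have "V \<bullet> z + (e + 1 / al t * (f y - grad y \<bullet> y)) \<le> (apg_Gamma (st t) + 1 / al t) * f z" for z
  proof -
    have "1 / al t * (f y + grad y \<bullet> (z - y)) \<le> 1 / al t * f z"
      using linearization[of y z] al[of t] by (intro mult_left_mono) auto
    then show ?thesis using IH(5)[of z]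
      by (simp add: V_def inner_add_left inner_diff_right diff_divide_distrib add_divide_distrib algebra_simps)
  qed
  ultimately show ?case unfolding st(1-3) by (auto simp: IH(3) st(4))
qed

lemma apg_iter_eq: "apg_step_sizes th al \<Longrightarrow> apg_iter (apg th al grad g S x0 t L) = t"
  and apg_x_in: "apg_step_sizes th al \<Longrightarrow> apg_x (apg th al grad g S x0 t L) \<in> S"
  using apg_invariant by blast+

text \<open>Combining the two halves of the invariant at \<open>z\<close> bounds the gap by
  \<open>L / 2 * (norm (z - x0))^2\<close> over the total weight, which is at least
  \<open>t^2 / 4\<close>. The comparison point is arbitrary because HOPS compares with a point of a
  sublevel set, not with a minimizer.\<close>

lemma apg_convergence:
  assumes sizes: "apg_step_sizes th al" and t: "t > 0" and z: "z \<in> S"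
  defines "x \<equiv> apg_x (apg th al grad g S x0 t L)"
  shows "f x + g x \<le> f z + g z + 2 * L * (norm (z - x0))\<^sup>2 / (real t)\<^sup>2"
proof -
  let ?\<Gamma> = "\<Sum>i<t. 1 / al i"
  obtain e V zt where "?\<Gamma> * (f x + g x) + L / 2 * (norm (z - zt))\<^sup>2
        \<le> L / 2 * (norm (z - x0))\<^sup>2 + V \<bullet> z + ?\<Gamma> * g z + e" "V \<bullet> z + e \<le> ?\<Gamma> * f z"
    using apg_invariant[OF sizes, of t] z unfolding x_def by metis
  moreover have "0 \<le> L / 2 * (norm (z - zt))\<^sup>2" using L by simp
  ultimately have "?\<Gamma> * (f x + g x - (f z + g z)) \<le> L / 2 * (norm (z - x0))\<^sup>2"
    by (simp add: algebra_simps)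
  moreover have growth: "(real t)\<^sup>2 / 4 \<le> ?\<Gamma>" by (rule apg_step_sizes_growth[OF sizes])
  \<comment> \<open>Lowering the weight to \<open>t^2 / 4\<close> is monotone only for a nonnegative
    gap; a negative one is trivial.\<close>
  ultimately have "(real t)\<^sup>2 / 4 * (f x + g x - (f z + g z)) \<le> L / 2 * (norm (z - x0))\<^sup>2"
  proof (cases "0 \<le> f x + g x - (f z + g z)")
    case True
    then show ?thesis using mult_right_mono[OF growth True] \<open>?\<Gamma> * _ \<le> _\<close> by linarith
  next
    case False
    then have "(real t)\<^sup>2 / 4 * (f x + g x - (f z + g z)) \<le> 0" by (intro mult_nonneg_nonpos) auto
    also have "0 \<le> L / 2 * (norm (z - x0))\<^sup>2" using L by simp
    finally show ?thesis .
  qed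
  then show ?thesis using t by (simp add: field_simps)
qed

end

section \<open>Local error bound and the HOPS recursion\<close>

text \<open>The comparison point is where the segment from \<open>x\<close> to its projection \<open>w\<close> on \<open>\<Omega>s\<close> meets the
  \<open>\<epsilon>\<close>-level set; \<open>w\<close> is also the projection of that point, so the error bound controls its
  distance to \<open>w\<close>, and convexity along the segment transfers this control to \<open>x\<close>.\<close>

lemma error_bound_near_sublevel:
  fixes F :: "'v::euclidean_space \<Rightarrow> real"
  assumes F: "convex_on UNIV F" and \<Omega>1: "convex \<Omega>1" "\<Omega>s \<subseteq> \<Omega>1"
    and \<Omega>s: "closed \<Omega>s" "\<Omega>s \<noteq> {}" "\<And>w. w \<in> \<Omega>s \<Longrightarrow> F w = Fmin"
    and \<epsilon>: "0 < \<epsilon>" and c: "0 < c"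
    and error_bound: "\<And>x. x \<in> \<Omega>1 \<Longrightarrow> F x \<le> Fmin + \<epsilon> \<Longrightarrow> infdist x \<Omega>s \<le> c * (F x - Fmin) powr \<theta>"
    and x: "x \<in> \<Omega>1" "F x - Fmin \<le> \<delta> + \<epsilon>" and \<delta>: "0 \<le> \<delta>"
  obtains z where "z \<in> \<Omega>1" "F z \<le> Fmin + \<epsilon>" "norm (z - x) \<le> c * \<delta> / \<epsilon> powr (1 - \<theta>)"
proof (cases "F x \<le> Fmin + \<epsilon>")
  case True
  then show ?thesis using that[of x] x c \<delta> by simp
next
  case False
  obtain w where w: "w \<in> \<Omega>s" "infdist x \<Omega>s = dist x w"
    using infdist_attains_inf[OF \<Omega>s(1,2), of x] by blast
  define p where "p s = w + s *\<^sub>R (x - w)" for s :: real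
  have "continuous_on {0..1} p" unfolding p_def by (intro continuous_intros)
  then have "continuous_on {0..1} (\<lambda>s. F (p s))"
    by (rule continuous_on_compose2[OF convex_on_continuous[OF open_UNIV F]]) simp
  moreover have "F (p 0) \<le> Fmin + \<epsilon>" "Fmin + \<epsilon> \<le> F (p 1)"
    using \<Omega>s(3)[OF w(1)] \<epsilon> False by (auto simp: p_def)
  \<comment> \<open>The level is hit exactly, so the error bound at \<open>p s\<close> has the value
    \<open>c * \<epsilon> powr \<theta>\<close>.\<close>
  ultimately obtain s where s: "0 \<le> s" "s \<le> 1" "F (p s) = Fmin + \<epsilon>"
    using IVT'[of "\<lambda>s. F (p s)" 0 "Fmin + \<epsilon>" 1] by auto
  have p_eq: "p s = (1 - s) *\<^sub>R w + s *\<^sub>R x" by (simp add: p_def algebra_simps)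
  have pin: "p s \<in> \<Omega>1" unfolding p_eq using \<Omega>1 w x s by (intro convexD) auto
  have "F (p s) \<le> (1 - s) * F w + s * F x"
    unfolding p_eq using F s by (intro convex_onD) auto
  then have "\<epsilon> \<le> s * (F x - Fmin)" using s \<Omega>s(3)[OF w(1)] by (simp add: algebra_simps)
  also have "\<dots> \<le> s * (\<delta> + \<epsilon>)" using x s by (intro mult_left_mono) auto
  finally have ratio: "(1 - s) * \<epsilon> \<le> s * \<delta>" by (simp add: algebra_simps)
  have "p s - x = (1 - s) *\<^sub>R (w - x)" by (simp add: p_def algebra_simps)
  then have px: "norm (p s - x) = (1 - s) * norm (x - w)"
    using s by (simp add: norm_minus_commute)
  \<comment> \<open>The triangle inequality expresses that \<open>w\<close> stays nearest to
    \<open>p s\<close>: a closer point of \<open>\<Omega>s\<close> would beat \<open>w\<close> for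
    \<open>x\<close> too.\<close>
  have "infdist x \<Omega>s \<le> infdist (p s) \<Omega>s + dist x (p s)" by (rule infdist_triangle)
  then have "s * norm (x - w) \<le> infdist (p s) \<Omega>s"
    using px w(2) by (simp add: dist_norm norm_minus_commute algebra_simps)
  also have "\<dots> \<le> c * \<epsilon> powr \<theta>" using error_bound[OF pin] s by simp
  finally have near: "s * norm (x - w) \<le> c * \<epsilon> powr \<theta>" .
  \<comment> \<open>\<open>ratio\<close> trades \<open>(1 - s) * \<epsilon>\<close> for
    \<open>s * \<delta>\<close>, which brings in the distance from \<open>p s\<close> to
    \<open>w\<close> controlled by \<open>near\<close>.\<close>
  have "norm (p s - x) * \<epsilon> = ((1 - s) * \<epsilon>) * norm (x - w)" using px by simp
  also have "\<dots> \<le> s * \<delta> * norm (x - w)" using ratio by (intro mult_right_mono) auto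
  also have "\<dots> = \<delta> * (s * norm (x - w))" by simp
  also have "\<dots> \<le> \<delta> * (c * \<epsilon> powr \<theta>)" using near \<delta> by (rule mult_left_mono)
  also have "\<epsilon> powr \<theta> = \<epsilon> / \<epsilon> powr (1 - \<theta>)"
    using \<epsilon> by (simp add: powr_diff)
  finally have "norm (p s - x) \<le> c * \<delta> / \<epsilon> powr (1 - \<theta>)"
    using \<epsilon> by (simp add: field_simps)
  then show ?thesis using that[OF pin] s by simp
qed

section \<open>One stage of HOPS and the induction over stages\<close>

context smoothing
begin

lemma smoothed_composite_problem:
  assumes "closed \<Omega>1" "convex \<Omega>1" "x \<in> \<Omega>1" "convex_on UNIV g" "A \<noteq> 0" "\<mu> > 0"
  shows "composite_problem \<Omega>1 (smoothed A \<Omega>2 \<phi> \<omega> \<mu>) g (gradient (smoothed A \<Omega>2 \<phi> \<omega> \<mu>))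
    ((op_norm A N)\<^sup>2 / \<mu>) x"
proof (rule composite_problem.intro)
  show "0 < (op_norm A N)\<^sup>2 / \<mu>" using op_norm_pos[OF N \<open>A \<noteq> 0\<close>] \<open>\<mu> > 0\<close> by simp
qed (rule assms smoothed_ge_linearization smoothed_descent)+

text \<open>Kept free of the error bound by an abstract radius \<open>R\<close>. For
  \<open>R = c * \<delta> / \<epsilon> powr (1 - \<theta>)\<close> both sides of the condition on
  \<open>t\<close> are proportional to \<open>\<delta>\<close>, so one \<open>t\<close> serves every
  stage.\<close>

lemma hops_stage_decrease:
  fixes g :: "real^'d \<Rightarrow> real" and st :: "(real^'d) hops_state"
  assumes \<Omega>1: "closed \<Omega>1" "convex \<Omega>1" "hops_x st \<in> \<Omega>1" and g: "convex_on UNIV g"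
    and A: "A \<noteq> 0" and D0: "D > 0" and b: "b > 1" and \<delta>: "\<delta> > 0" and \<mu>: "hops_mu st = \<delta> / (b * D\<^sup>2)"
    and sizes: "apg_step_sizes th al"
    and z: "z \<in> \<Omega>1" "norm (z - hops_x st) \<le> R"
    and R: "R > 0" "2 * b * D * op_norm A N * R \<le> real t * \<delta>"
  defines "st' \<equiv> hops_stage th al A \<Omega>1 \<Omega>2 g \<phi> \<omega> N b t st"
  shows "hops_x st' \<in> \<Omega>1" "hops_mu st' = (\<delta> / b) / (b * D\<^sup>2)" "hops_iter st' = hops_iter st + t"
    "max_part A \<Omega>2 \<phi> (hops_x st') + g (hops_x st') \<le> max_part A \<Omega>2 \<phi> z + g z + \<delta> / b"
proof -
  define \<mu> where "\<mu> = hops_mu st"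
  have \<mu>_pos: "\<mu> > 0" unfolding \<mu>_def \<mu> using \<delta> b D0 by simp
  define M where "M = op_norm A N"
  have M: "M > 0" unfolding M_def using op_norm_pos[OF N A] .
  interpret composite_problem \<Omega>1 "smoothed A \<Omega>2 \<phi> \<omega> \<mu>" g "gradient (smoothed A \<Omega>2 \<phi> \<omega> \<mu>)"
    "(op_norm A N)\<^sup>2 / \<mu>" "hops_x st"
    using \<Omega>1 g A \<mu>_pos by (rule smoothed_composite_problem)
  define r where "r = apg th al (gradient (smoothed A \<Omega>2 \<phi> \<omega> \<mu>)) g \<Omega>1 (hops_x st) t ((op_norm A N)\<^sup>2 / \<mu>)"
  have st': "hops_x st' = apg_x r" "hops_mu st' = \<mu> / b" "hops_iter st' = hops_iter st + apg_iter r"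
    by (simp_all add: st'_def hops_stage_def Let_def r_def \<mu>_def)
  show "hops_x st' \<in> \<Omega>1" unfolding st' r_def by (rule apg_x_in[OF sizes])
  show "hops_mu st' = (\<delta> / b) / (b * D\<^sup>2)" unfolding st' \<mu>_def \<mu> by simp
  show "hops_iter st' = hops_iter st + t" unfolding st' r_def by (simp add: apg_iter_eq[OF sizes])
  have "0 < 2 * b * D * M * R" using b D0 M R by simp
  then have t: "t > 0" using R(2) \<delta> unfolding M_def[symmetric] by (cases t) auto
  have "M * norm (z - hops_x st) \<le> M * R" using z M by (intro mult_left_mono) auto
  also have "\<dots> \<le> real t * \<delta> / (2 * b * D)"
    using R(2) b D0 by (simp add: M_def field_simps)
  finally have "(M * norm (z - hops_x st))\<^sup>2 \<le> (real t * \<delta> / (2 * b * D))\<^sup>2"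
    using M by (intro power_mono) auto
  then have "2 / (\<mu> * (real t)\<^sup>2) * (M * norm (z - hops_x st))\<^sup>2
      \<le> 2 / (\<mu> * (real t)\<^sup>2) * (real t * \<delta> / (2 * b * D))\<^sup>2"
    using \<mu>_pos by (intro mult_left_mono) auto
  also have "\<dots> = \<delta> / (2 * b)"
    unfolding \<mu>_def \<mu> using b D0 \<delta> t by (simp add: field_simps power2_eq_square)
  also have "2 / (\<mu> * (real t)\<^sup>2) * (M * norm (z - hops_x st))\<^sup>2
      = 2 * ((op_norm A N)\<^sup>2 / \<mu>) * (norm (z - hops_x st))\<^sup>2 / (real t)\<^sup>2"
    by (simp add: M_def power_mult_distrib)
  finally have "smoothed A \<Omega>2 \<phi> \<omega> \<mu> (apg_x r) + g (apg_x r) \<le> smoothed A \<Omega>2 \<phi> \<omega> \<mu> z + g z + \<delta> / (2 * b)"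
    using apg_convergence[OF sizes t z(1)] unfolding r_def by linarith
  moreover have "\<mu> * D\<^sup>2 / 2 = \<delta> / (2 * b)" unfolding \<mu>_def \<mu> using D0 by simp
  \<comment> \<open>Smoothing only lowers the value at \<open>z\<close>, so its error is paid once,
    at the output point.\<close>
  ultimately have "max_part A \<Omega>2 \<phi> (apg_x r) + g (apg_x r) \<le> max_part A \<Omega>2 \<phi> z + g z + (\<delta> / (2 * b) + \<delta> / (2 * b))"
    using smoothed_le_max_part[of \<mu> z] max_part_le_smoothed[of \<mu> "apg_x r"] \<mu>_pos by linarith
  then show "max_part A \<Omega>2 \<phi> (hops_x st') + g (hops_x st') \<le> max_part A \<Omega>2 \<phi> z + g z + \<delta> / b"
    unfolding st' by simp
qed

end

text \<open>\<open>K\<close> renders the order bound on \<open>t\<close>; the choice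
  \<open>nat \<lceil>T\<rceil>\<close> makes the count exact. Positive \<open>D\<close> and nonzero
  \<open>A\<close> keep the initial smoothing parameter and the constants \<open>L\<close>
  meaningful.\<close>

theorem theorem4:
  fixes A :: "real^'d^'n"
    and \<Omega>1 \<Omega>s :: "(real^'d) set"
    and \<Omega>2 :: "(real^'n) set"
    and g F :: "real^'d \<Rightarrow> real"
    and \<phi> \<omega> N :: "real^'n \<Rightarrow> real"
    and x0 :: "real^'d"
    and D \<epsilon>0 \<epsilon> \<theta> c b Fmin T :: real
    and m :: nat
    and th al :: "nat \<Rightarrow> real"
  assumes "closed \<Omega>1" "convex \<Omega>1"
    and "closed \<Omega>2" "convex \<Omega>2" "bounded \<Omega>2" "\<Omega>2 \<noteq> {}"
    and "A \<noteq> 0"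
    and "convex_on UNIV g" "convex_on UNIV \<phi>"
    and F_def: "F = (\<lambda>x. max_part A \<Omega>2 \<phi> x + g x)"
    and Fmin_def: "Fmin = (INF x\<in>\<Omega>1. F x)"
    and \<Omega>s_def: "\<Omega>s = minimizers F \<Omega>1"
    and "x0 \<in> \<Omega>1" "F x0 - Fmin \<le> \<epsilon>0"
    and "is_norm N"
    and "\<forall>u\<in>\<Omega>2. 0 \<le> \<omega> u" "continuous_on \<Omega>2 \<omega>" "strongly_convex_on 1 N \<Omega>2 \<omega>"
    and "D > 0" "(SUP u\<in>\<Omega>2. \<omega> u) \<le> D\<^sup>2 / 2"
    and "\<Omega>s \<noteq> {}" "convex \<Omega>s" "compact \<Omega>s"
    and "0 < \<epsilon>" "\<epsilon> \<le> \<epsilon>0"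
    and "0 < \<theta>" "\<theta> \<le> 1" "c > 0"
    and error_bound: "\<forall>x\<in>\<Omega>1. F x \<le> Fmin + \<epsilon> \<longrightarrow> infdist x \<Omega>s \<le> c * (F x - Fmin) powr \<theta>"
    and "b > 1"
    and "apg_step_sizes th al"
    and m_def: "m = nat \<lceil>log b (\<epsilon>0 / \<epsilon>)\<rceil>"
    and T_def: "T = 2 * b * c * D * op_norm A N / \<epsilon> powr (1 - \<theta>)"
  shows "(\<forall>t K. T \<le> real t \<and> real t \<le> K * T \<longrightarrow>
            F (hops_x (hops th al A \<Omega>1 \<Omega>2 g \<phi> \<omega> N D b \<epsilon>0 x0 m t)) - Fmin \<le> 2 * \<epsilon> \<and>
            real (hops_iter (hops th al A \<Omega>1 \<Omega>2 g \<phi> \<omega> N D b \<epsilon>0 x0 m t))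
              \<le> K * (T * real_of_int \<lceil>log b (\<epsilon>0 / \<epsilon>)\<rceil>)) \<and>
         (let H = hops th al A \<Omega>1 \<Omega>2 g \<phi> \<omega> N D b \<epsilon>0 x0 m (nat \<lceil>T\<rceil>)
          in F (hops_x H) - Fmin \<le> 2 * \<epsilon> \<and>
             int (hops_iter H) = \<lceil>T\<rceil> * \<lceil>log b (\<epsilon>0 / \<epsilon>)\<rceil>)"
proof -
  have compact: "compact \<Omega>2" using \<open>closed \<Omega>2\<close> \<open>bounded \<Omega>2\<close> using compact_eq_bounded_closed by blast
  interpret smoothing A \<Omega>2 \<phi> \<omega> N D
    using \<open>\<forall>u\<in>\<Omega>2. 0 \<le> \<omega> u\<close> by (intro smoothing.intro compact assms) simp
  have F_convex: "convex_on UNIV F"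
    unfolding F_def using convex_max_part \<open>convex_on UNIV g\<close> by (rule convex_on_add)
  have M: "op_norm A N > 0" using op_norm_pos[OF N \<open>A \<noteq> 0\<close>] .
  have \<Omega>s_sub: "\<Omega>s \<subseteq> \<Omega>1" by (auto simp: \<Omega>s_def minimizers_def is_arg_min_def)
  have \<Omega>s_val: "F w = Fmin" if "w \<in> \<Omega>s" for w
  proof -
    have "w \<in> \<Omega>1" "\<And>z. z \<in> \<Omega>1 \<Longrightarrow> F w \<le> F z"
      using that by (auto simp: \<Omega>s_def minimizers_def is_arg_min_def not_less)
    then have "(INF x\<in>\<Omega>1. F x) = F w" by (intro cInf_eq_minimum) auto
    then show ?thesis by (simp add: Fmin_def)
  qed
  define P where "P = \<epsilon> powr (1 - \<theta>)"
  have P: "P > 0" using \<open>0 < \<epsilon>\<close> by (simp add: P_def)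
  have T_pos: "T > 0" unfolding T_def using \<open>b > 1\<close> \<open>c > 0\<close> \<open>D > 0\<close> \<open>0 < \<epsilon>\<close> M by simp
  \<comment> \<open>The state after \<open>s\<close> stages already holds the smoothing parameter of
    stage \<open>s + 1\<close>, hence the power \<open>b ^ s\<close> in the invariant.\<close>
  define H where "H t s = (hops_stage th al A \<Omega>1 \<Omega>2 g \<phi> \<omega> N b t ^^ s)
       \<lparr> hops_x = x0, hops_mu = \<epsilon>0 / (b * D\<^sup>2), hops_iter = 0 \<rparr>" for t s
  have stages: "hops_x (H t s) \<in> \<Omega>1 \<and> hops_mu (H t s) = (\<epsilon>0 / b ^ s) / (b * D\<^sup>2) \<and>
      hops_iter (H t s) = s * t \<and> F (hops_x (H t s)) - Fmin \<le> \<epsilon>0 / b ^ s + \<epsilon>"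
    if t: "T \<le> real t" for t s
  proof (induction s)
    case 0
    show ?case using \<open>x0 \<in> \<Omega>1\<close> \<open>F x0 - Fmin \<le> \<epsilon>0\<close> \<open>0 < \<epsilon>\<close> by (simp add: H_def)
  next
    case (Suc s)
    define \<delta> where "\<delta> = \<epsilon>0 / b ^ s"
    have \<delta>: "\<delta> > 0" using \<open>0 < \<epsilon>\<close> \<open>\<epsilon> \<le> \<epsilon>0\<close> \<open>b > 1\<close> by (simp add: \<delta>_def)
    define R where "R = c * \<delta> / P"
    have "R > 0" using \<open>c > 0\<close> \<delta> P by (simp add: R_def)
    have IH: "hops_x (H t s) \<in> \<Omega>1" "hops_mu (H t s) = \<delta> / (b * D\<^sup>2)" "hops_iter (H t s) = s * t"
      "F (hops_x (H t s)) - Fmin \<le> \<delta> + \<epsilon>" using Suc by (auto simp: \<delta>_def)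
    obtain z where z: "z \<in> \<Omega>1" "F z \<le> Fmin + \<epsilon>" "norm (z - hops_x (H t s)) \<le> R"
      using error_bound_near_sublevel[OF F_convex \<open>convex \<Omega>1\<close> \<Omega>s_sub compact_imp_closed[OF \<open>compact \<Omega>s\<close>]
        \<open>\<Omega>s \<noteq> {}\<close> \<Omega>s_val \<open>0 < \<epsilon>\<close> \<open>c > 0\<close> _ IH(1,4), of \<theta>] error_bound \<delta>
      unfolding R_def P_def by (metis less_imp_le)
    have "2 * b * D * op_norm A N * R = T * \<delta>"
      unfolding R_def T_def P_def by simp
    also have "\<dots> \<le> real t * \<delta>" using t \<delta> by simp
    finally have "2 * b * D * op_norm A N * R \<le> real t * \<delta>" .
    note step = hops_stage_decrease[OF \<open>closed \<Omega>1\<close> \<open>convex \<Omega>1\<close> IH(1) \<open>convex_on UNIV g\<close> \<open>A \<noteq> 0\<close>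
        \<open>D > 0\<close> \<open>b > 1\<close> \<delta> IH(2) \<open>apg_step_sizes th al\<close> z(1,3) \<open>R > 0\<close> this]
    have "H t (Suc s) = hops_stage th al A \<Omega>1 \<Omega>2 g \<phi> \<omega> N b t (H t s)" by (simp add: H_def)
    moreover have "\<epsilon>0 / b ^ Suc s = \<delta> / b" by (simp add: \<delta>_def)
    \<comment> \<open>The slack \<open>\<epsilon>\<close> does not accumulate: it is the excess of
      the comparison point \<open>z\<close>, chosen afresh in each stage.\<close>
    ultimately show ?case using step z(2) IH(3) by (simp add: F_def)
  qed
  \<comment> \<open>The logarithm is nonnegative, so \<open>nat\<close> truncates nothing in
    \<open>m\<close>.\<close>
  have "1 \<le> \<epsilon>0 / \<epsilon>" using \<open>0 < \<epsilon>\<close> \<open>\<epsilon> \<le> \<epsilon>0\<close> by simp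
  then have "0 \<le> log b (\<epsilon>0 / \<epsilon>)" using \<open>b > 1\<close> by simp
  then have m: "int m = \<lceil>log b (\<epsilon>0 / \<epsilon>)\<rceil>" by (simp add: m_def)
  then have "log b (\<epsilon>0 / \<epsilon>) \<le> real m" by linarith
  then have "\<epsilon>0 / \<epsilon> \<le> b ^ m"
    using \<open>b > 1\<close> \<open>1 \<le> \<epsilon>0 / \<epsilon>\<close> by (simp add: log_le_iff powr_realpow)
  then have last: "\<epsilon>0 / b ^ m \<le> \<epsilon>"
    using \<open>0 < \<epsilon>\<close> \<open>b > 1\<close> by (simp add: field_simps)
  have hops: "hops th al A \<Omega>1 \<Omega>2 g \<phi> \<omega> N D b \<epsilon>0 x0 m t = H t m" for t
    by (simp add: hops_def H_def)
  have accuracy: "F (hops_x (H t m)) - Fmin \<le> 2 * \<epsilon>" and iterations: "hops_iter (H t m) = m * t"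
    if "T \<le> real t" for t
    using stages[OF that, of m] last by auto
  have rounded: "T \<le> real (nat \<lceil>T\<rceil>)" "int (nat \<lceil>T\<rceil>) = \<lceil>T\<rceil>" using T_pos by linarith+
  show ?thesis
    unfolding hops Let_def
  proof (intro conjI allI impI; (elim conjE)?)
    fix t :: nat and K
    assume t: "T \<le> real t" "real t \<le> K * T"
    show "F (hops_x (H t m)) - Fmin \<le> 2 * \<epsilon>" using accuracy[OF t(1)] .
    have "real m * real t \<le> real m * (K * T)" using t(2) by (rule mult_left_mono) simp
    moreover have "real_of_int \<lceil>log b (\<epsilon>0 / \<epsilon>)\<rceil> = real m" by (simp flip: m)
    ultimately show "real (hops_iter (H t m)) \<le> K * (T * real_of_int \<lceil>log b (\<epsilon>0 / \<epsilon>)\<rceil>)"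
      using iterations[OF t(1)] by (simp add: algebra_simps)
  next
    show "F (hops_x (H (nat \<lceil>T\<rceil>) m)) - Fmin \<le> 2 * \<epsilon>" using accuracy[OF rounded(1)] .
    show "int (hops_iter (H (nat \<lceil>T\<rceil>) m)) = \<lceil>T\<rceil> * \<lceil>log b (\<epsilon>0 / \<epsilon>)\<rceil>"
      using iterations[OF rounded(1)] rounded(2) m by simp
  qed
qed

end
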